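(* Let $\mathcal{C}(\alpha_0,\dots,\alpha_{n-1},b_n)$ be the $(n+1)\times(n+1)$ matrix defined in the context, where $\alpha_j\in\mathbb{D}$ ($j=0,1,\dots,n-1$) and $b_n\in\mathbb{S}^1$. The following hold. (i) Let $\beta\in\mathbb{S}^1\setminus\{1\}$ and define $$\mathcal{C}_m^{\beta}:=\mathcal{C}(\alpha_0,\dots,\alpha_{m-1},\beta\alpha_m,\dots,\beta\alpha_{n-1},\beta b_n)\quad(0\le m<n),\qquad \mathcal{C}_n^{\beta}:=\mathcal{C}(\alpha_0,\dots,\alpha_{n-1},\beta b_n).$$ Then the eigenvalues of $\mathcal{C}(\alpha_0,\dots,\alpha_{n-1},b_n)$ and of $\mathcal{C}_m^{\beta}$ strictly interlace on $\mathbb{S}^1$ for each $0\le m\le n$. (ii) For each $0\le m<n$, let $b_m\in\mathbb{S}^1$. For each $\zeta\in\mathbb{S}^1$ define recursively $$b_n(\zeta):=b_n,\qquad b_j(\zeta):=\frac{\overline{\zeta}\,\alpha_j+b_{j+1}(\zeta)}{\overline{\alpha}_j\,b_{j+1}(\zeta)+\overline{\zeta}}\quad(j=n-1,\dots,1,0).$$ Set $$C:=\{\zeta\in\mathbb{S}^1: b_m(\zeta)=b_m\},\qquad \gamma_m:=\frac{\alpha_m-b_m}{\overline{\alpha}_m b_m-1},$$ $$\mathcal{N}:=\mathcal{C}(\alpha_{m+1},\dots,\alpha_{n-1},b_n)\,\mathcal{D},\qquad \mathcal{D}:=\operatorname{diag}(\gamma_m,\mathcal{I}),$$ $$A:=C\cap\sigma\big(\mathcal{C}(\alpha_0,\dots,\alpha_{m-1},b_m)\big),\qquad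 B:=\sigma(\mathcal{N})\setminus A.$$ Then $\mathcal{C}(\alpha_0,\dots,\alpha_{n-1},b_n)$ and $\mathcal{C}(\alpha_0,\dots,\alpha_{m-1},b_m)$ have at most $\min\{m+1,n-m\}$ common eigenvalues. More precisely, the set of common eigenvalues of $\mathcal{C}(\alpha_0,\dots,\alpha_{n-1},b_n)$ and $\mathcal{C}(\alpha_0,\dots,\alpha_{m-1},b_m)$ is $A$, and $A$ is also given by $$A=\sigma(\mathcal{N})\cap\sigma\big(\mathcal{C}(\alpha_0,\dots,\alpha_{m-1},b_m)\big).$$ Furthermore, the elements of the sets $\sigma\big(\mathcal{C}(\alpha_0,\dots,\alpha_{n-1},b_n)\big)\setminus A$ and $\sigma\big(\mathcal{C}(\alpha_0,\dots,\alpha_{m-1},b_m)\big)\cup B$ strictly interlace on $\mathbb{S}^1$.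
   Context: $\mathbb{D}:=\{z\in\mathbb{C}:|z|<1\}$, $\mathbb{S}^1:=\{z\in\mathbb{C}:|z|=1\}$. $\sigma(\mathcal{A})$ denotes the spectrum (set of eigenvalues) of $\mathcal{A}$, and $\mathcal{I}$ the identity matrix of the appropriate order (so $\mathcal{D}$ in (ii) is a diagonal matrix of order $n-m$). $\oplus$ denotes the block-diagonal direct sum. For $\alpha\in\mathbb{D}$ put $\rho:=(1-|\alpha|^2)^{1/2}$ and $\Theta(\alpha):=\begin{pmatrix}\overline{\alpha}&\rho\\ \rho&-\alpha\end{pmatrix}$. Given an array $(\alpha_0,\dots,\alpha_{n-1},b_n)$ with $\alpha_j\in\mathbb{D}$ and $b_n\in\mathbb{S}^1$, put $\Theta_j:=\Theta(\alpha_j)$ and define the $(n+1)\times(n+1)$ matrix $\mathcal{C}(\alpha_0,\dots,\alpha_{n-1},b_n):=\mathcal{L}\mathcal{M}$, where if $n$ is even: $\mathcal{L}:=\Theta_0\oplus\Theta_2\oplus\cdots\oplus\Theta_{n-2}\oplus\overline{b}_n$ and $\mathcal{M}:=1\oplus\Theta_1\oplus\Theta_3\oplus\cdots\oplus\Theta_{n-1}$; if $n$ is odd: $\mathcal{L}:=\Theta_0\oplus\Theta_2\oplus\cdots\oplus\Theta_{n-1}$ and $\mathcal{M}:=1\oplus\Theta_1\oplus\Theta_3\oplus\cdots\oplus\Theta_{n-2}\oplus\overline{b}_n$. For an array consisting of a single element $b\in\mathbb{S}^1$ (the case $n=0$), $\mathcal{C}(b)$ is the $1\times1$ matrix $(\overline{b})$.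 The matrix built from any other array, e.g. $(\alpha_{m+1},\dots,\alpha_{n-1},b_n)$ (of order $n-m$) or $(\alpha_0,\dots,\alpha_{m-1},b_m)$ (of order $m+1$), is obtained by the same construction after re-indexing the array from $0$. Interlacing: two finite subsets $\{\zeta_1,\dots,\zeta_m\}$ and $\{\xi_1,\dots,\xi_n\}$ ($1\le m\le n$) of $\mathbb{S}^1$ interlace (resp. strictly interlace) whenever there exist $n-m$ points $\zeta_{m+1},\dots,\zeta_n\in\mathbb{S}^1$ such that any closed arc (resp. open arc) on $\mathbb{S}^1$ connecting two distinct elements of $\{\zeta_1,\dots,\zeta_n\}$ contains at least one element of $\{\xi_1,\dots,\xi_n\}$, and vice versa. *)

theory Defs
  imports "HOL-Analysis.Analysis" "Jordan_Normal_Form.Spectral_Radius"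
begin

definition const_mat1 :: "complex \<Rightarrow> complex mat" where
  "const_mat1 c = mat 1 1 (\<lambda>_. c)"

definition Theta :: "complex \<Rightarrow> complex mat" where
  "Theta \<alpha> =
    (let \<rho> = complex_of_real (sqrt (1 - (cmod \<alpha>)\<^sup>2))
     in mat_of_rows_list 2 [[cnj \<alpha>, \<rho>], [\<rho>, - \<alpha>]])"

text \<open>
  An array \<open>(\<alpha>\<^sub>0, \<dots>, \<alpha>\<^sub>n\<^sub>-\<^sub>1, b)\<close> is represented by the list \<open>as\<close> of its first \<open>n\<close> entries
  together with its last entry \<open>b\<close>; using lists makes the re-indexing of sub-arrays from \<open>0\<close>
  automatic.  The trailing block \<open>cnj b\<close> goes to the left factor if \<open>n\<close> is even and to the right
  factor if \<open>n\<close> is odd.  For \<open>n = 0\<close> the product is the matrix \<open>(cnj b)\<close> of order one.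
\<close>

definition cmv_L :: "complex list \<Rightarrow> complex \<Rightarrow> complex mat" where
  "cmv_L as b = diag_block_mat
     (map (\<lambda>j. Theta (as ! j)) (filter even [0..<length as]) @
      (if even (length as) then [const_mat1 (cnj b)] else []))"

definition cmv_M :: "complex list \<Rightarrow> complex \<Rightarrow> complex mat" where
  "cmv_M as b = diag_block_mat
     (const_mat1 1 # map (\<lambda>j. Theta (as ! j)) (filter odd [0..<length as]) @
      (if odd (length as) then [const_mat1 (cnj b)] else []))"

definition cmv :: "complex list \<Rightarrow> complex \<Rightarrow> complex mat" where
  "cmv as b = cmv_L as b * cmv_M as b"

text \<open>
  The backward recursion: if \<open>as\<close> lists \<open>\<alpha>\<^sub>j, \<dots>, \<alpha>\<^sub>n\<^sub>-\<^sub>1\<close>, then \<open>back_rec \<zeta> as b\<^sub>n\<close> is the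
  value \<open>b\<^sub>j(\<zeta>)\<close>.
\<close>

primrec back_rec :: "complex \<Rightarrow> complex list \<Rightarrow> complex \<Rightarrow> complex" where
  "back_rec \<zeta> [] b = b"
| "back_rec \<zeta> (a # as) b =
    (cnj \<zeta> * a + back_rec \<zeta> as b) / (cnj a * back_rec \<zeta> as b + cnj \<zeta>)"

text \<open>For \<open>x \<noteq> y\<close> on the unit circle there are exactly two such arcs.\<close>

definition open_arcs :: "complex \<Rightarrow> complex \<Rightarrow> complex set set" where
  "open_arcs x y =
    {cis ` {s<..<t} | s t. s < t \<and> t < s + 2 * pi \<and> {cis s, cis t} = {x, y}}"

definition open_arcs_meet :: "complex set \<Rightarrow> complex set \<Rightarrow> bool" where
  "open_arcs_meet Z X \<longleftrightarrow>
    (\<forall>x\<in>Z. \<forall>y\<in>Z. x \<noteq> y \<longrightarrow> (\<forall>J\<in>open_arcs x y. J \<inter> X \<noteq> {}))"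

text \<open>
  The first set is the one with at most as many elements as the second; it is filled up with
  \<open>card X - card Z\<close> further points of the circle, given by \<open>p\<close>.
\<close>

definition strictly_interlace :: "complex set \<Rightarrow> complex set \<Rightarrow> bool" where
  "strictly_interlace Z X \<longleftrightarrow>
    finite Z \<and> finite X \<and> Z \<subseteq> sphere 0 1 \<and> X \<subseteq> sphere 0 1 \<and>
    1 \<le> card Z \<and> card Z \<le> card X \<and>
    (\<exists>p :: nat \<Rightarrow> complex.
       (\<forall>i\<in>{card Z<..card X}. p i \<in> sphere 0 1) \<and>
       (let Z' = Z \<union> p ` {card Z<..card X}
        in open_arcs_meet Z' X \<and> open_arcs_meet X Z'))"

end

theory Submission
  imports Defs
begin

text \<open>
  On the circle, \<open>f\<^sub>j(\<zeta>) = b\<^sub>j(\<zeta>)\<close> is a Schur recursion: \<open>f\<^sub>j\<close> is a Moebius image of \<open>\<zeta> f\<^sub>j\<^sub>+\<^sub>1\<close>, so it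
  has a strictly increasing lift to the line, of degree \<open>n - j\<close>. A solution of \<open>\<zeta> f\<^sub>0(\<zeta>) = \<gamma>\<close> yields
  an explicit eigenvector of \<open>\<C> diag(\<gamma>, \<I>)\<close>. The degree shows that there are as many solutions as the
  order of the matrix, hence the spectrum is exactly the solution set.

  Solving \<open>\<zeta> f\<^sub>0 = 1\<close> for \<open>f\<^sub>m\<close> turns it into \<open>g f\<^sub>m = 1\<close>, where \<open>g\<close> depends on the entries before
  \<open>m\<close> only and has a lift of degree \<open>m + 1\<close>. In (i), the two spectra are the level sets of the single
  increasing function \<open>g f\<^sub>m\<close> at \<open>1\<close> and \<open>cnj \<beta>\<close>. In (ii), with \<open>F = g b\<^sub>m\<close> and \<open>G = cnj b\<^sub>m f\<^sub>m\<close>,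
  they are \<open>{F G = 1}\<close> and \<open>{F = 1}\<close>, while \<open>\<N>\<close> has spectrum \<open>{G = 1}\<close>. Interlacing follows from the
  intermediate value theorem for the lifts: on an arc free of \<open>F = 1\<close> and \<open>G = 1\<close> the arguments of
  \<open>F\<close> and \<open>G\<close> each stay in an open interval of length \<open>2\<pi>\<close>.
\<close>

section \<open>The unit circle\<close>

lemma cis_eq_iff_int: "cis s = cis t \<longleftrightarrow> (\<exists>k::int. s = t + 2 * pi * k)"
  using sin_cos_eq_iff[of s t] by (auto simp: complex_eq_iff)

lemma cis_add_int [simp]: "cis (t + 2 * pi * of_int k) = cis t"
  by (auto simp: cis_eq_iff_int)

lemma sphere_eq_cis: 
  assumes "w \<in> sphere 0 1"
  obtains t where "w = cis t" "0 \<le> t" "t < 2 * pi"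
proof -
  have "norm w = 1" using assms by simp
  from complex_unimodular_polar[OF this] show thesis
    using that by (metis cis.code)
qed

lemma cnj_unimodular: "cmod z = 1 \<Longrightarrow> cnj z * z = 1"
  by (metis complex_norm_square mult.commute of_real_1 power_one)

lemma cnj_eq_inverse: "cmod z = 1 \<Longrightarrow> cnj z = inverse z"
  using cnj_unimodular[of z] by (metis inverse_unique mult.commute)

lemma two_pi_mult_less: "2 * pi * x < 2 * pi * y \<Longrightarrow> x < y"
  by simp

lemma unimodular_mult_eq_1_iff:
  assumes "cmod b = 1"
  shows "b * z = 1 \<longleftrightarrow> z = cnj b"
proof
  assume "b * z = 1"
  then have "cnj b = cnj b * b * z" by (simp add: mult.assoc)
  then show "z = cnj b" using cnj_unimodular[OF assms] by simp
qed (use cnj_unimodular[OF assms] in \<open>simp add: mult.commute\<close>)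

section \<open>Lifts of circle maps\<close>

text \<open>\<open>d\<close> is the winding number. Strictness is asked only for positive
  \<open>d\<close>, so that constants count as lifts of degree 0; weak monotonicity holds in every
  degree, so that a sum with one strict summand is strict.\<close>

definition circle_lift :: "nat \<Rightarrow> (complex \<Rightarrow> complex) \<Rightarrow> (real \<Rightarrow> real) \<Rightarrow> bool" where
  "circle_lift d F \<phi> \<longleftrightarrow>
     (\<forall>t. F (cis t) = cis (\<phi> t)) \<and> continuous_on UNIV \<phi> \<and>
     mono \<phi> \<and> (0 < d \<longrightarrow> strict_mono \<phi>) \<and>
     (\<forall>t. \<phi> (t + 2 * pi) = \<phi> t + 2 * pi * d)"

lemma circle_lift_const: "circle_lift 0 (\<lambda>_. cis s) (\<lambda>_. s)"
  by (auto simp: circle_lift_def mono_def)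

lemma circle_lift_ident: "circle_lift 1 (\<lambda>z. z) (\<lambda>t. t)"
  by (auto simp: circle_lift_def mono_def strict_mono_def)

lemma circle_lift_mult:
  assumes "circle_lift d F \<phi>" "circle_lift e G \<psi>"
  shows "circle_lift (d + e) (\<lambda>z. F z * G z) (\<lambda>t. \<phi> t + \<psi> t)"
proof -
  have "strict_mono (\<lambda>t. \<phi> t + \<psi> t)" if "0 < d + e"
    using that assms unfolding circle_lift_def strict_mono_def mono_def
    by (metis add_gr_0 add_le_less_mono add_less_le_mono less_imp_le)
  then show ?thesis
    using assms
    by (auto simp: circle_lift_def cis_mult mono_def algebra_simps intro!: continuous_intros add_mono)
qed

lemma moebius_denominator:
  assumes "cmod a < 1" "cmod w = 1"
  shows "0 < Re (1 + cnj a * w)"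
proof -
  have "\<bar>Re (cnj a * w)\<bar> < 1"
    using abs_Re_le_cmod[of "cnj a * w"] assms by (simp add: norm_mult)
  then show ?thesis by simp
qed

lemma moebius_denominator_nonzero:
  assumes "cmod a < 1" "cmod w = 1"
  shows "1 + cnj a * w \<noteq> 0" "1 - cnj a * w \<noteq> 0" "1 - a * w \<noteq> 0"
proof -
  have nz: "1 + cnj c * w \<noteq> 0" if "cmod c < 1" for c
    using moebius_denominator[OF that assms(2)] by (metis less_irrefl zero_complex.sel(1))
  show "1 + cnj a * w \<noteq> 0" "1 - cnj a * w \<noteq> 0" "1 - a * w \<noteq> 0"
    using nz[of a] nz[of "- a"] nz[of "- cnj a"] assms(1) by simp_all
qed

text \<open>On the circle, \<open>(w + a) / (1 + cnj a * w)\<close> is \<open>w * cnj q / q\<close> with \<open>q = 1 + cnj a * w\<close>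
  in the right half plane, so \<open>t - 2 * Arg q\<close> is a continuous lift.\<close>

lemma circle_lift_moebius_ident:
  assumes a: "cmod a < 1"
  obtains \<mu> where "circle_lift 1 (\<lambda>w. (w + a) / (1 + cnj a * w)) \<mu>"
proof -
  define q where "q t = 1 + cnj a * cis t" for t
  define \<mu> where "\<mu> t = t - 2 * Arg (q t)" for t
  have Re_q: "0 < Re (q t)" for t
    using moebius_denominator[OF a, of "cis t"] by (simp add: q_def)
  then have q_nz: "q t \<noteq> 0" for t
    by (metis less_irrefl zero_complex.sel(1))
  have lift: "(cis t + a) / (1 + cnj a * cis t) = cis (\<mu> t)" for t
  proof -
    have *: "cis (Arg (q t)) = q t / cmod (q t)"
      using cis_Arg[OF q_nz, of t] by (simp add: sgn_eq)
    have "cis (\<mu> t) = cis t * inverse (cis (Arg (q t)))^2"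
      by (simp add: \<mu>_def power2_eq_square cis_mult)
    also have "\<dots> = cis t * (cmod (q t))^2 / (q t)^2"
      using q_nz[of t] by (simp add: * power_divide field_simps)
    also have "\<dots> = cis t * cnj (q t) / q t"
      using q_nz[of t] unfolding of_real_power[symmetric] complex_norm_square
      by (simp add: power2_eq_square field_simps)
    also have "cis t * cnj (q t) = cis t + a"
      using cnj_unimodular[of "cis t"] by (simp add: q_def algebra_simps)
    finally show ?thesis by (simp add: q_def)
  qed
  have cont: "continuous_on UNIV \<mu>"
    unfolding \<mu>_def q_def
    by (intro continuous_intros) (use Re_q in \<open>auto simp: q_def complex_nonpos_Reals_iff not_le\<close>)
  have per: "\<mu> (t + 2 * pi) = \<mu> t + 2 * pi" for t
    using cis_add_int[of t 1] by (simp add: \<mu>_def q_def)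
  have per': "\<mu> (t + 2 * pi * of_nat k) = \<mu> t + 2 * pi * of_nat k" for t k
  proof (induction k)
    case (Suc k)
    then show ?case using per[of "t + 2 * pi * of_nat k"] by (simp add: algebra_simps)
  qed simp
  have per_int: "\<mu> (t + 2 * pi * of_int k) = \<mu> t + 2 * pi * of_int k" for t k
  proof (cases k rule: int_cases2)
    case (nonneg n)
    then show ?thesis using per'[of t n] by simp
  next
    case (nonpos n)
    then show ?thesis using per'[of "t + 2 * pi * of_int k" n] by simp
  qed
  \<comment> \<open>The Moebius map is injective on the circle because \<open>1 - a * cnj a\<close>
    is nonzero. Equal values thus force \<open>s\<close> and \<open>t\<close> to differ by a
    multiple of 2 pi, and \<open>per_int\<close> makes that multiple 0.\<close>
  have inj: "inj \<mu>"
  proof (rule injI)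
    fix s t assume eq: "\<mu> s = \<mu> t"
    have nz: "1 + cnj a * cis s \<noteq> 0" "1 + cnj a * cis t \<noteq> 0"
      using q_nz by (auto simp: q_def)
    have "(cis s + a) * (1 + cnj a * cis t) = (cis t + a) * (1 + cnj a * cis s)"
      using lift[of s] lift[of t] eq nz by (simp add: divide_simps)
    then have "(cis s - cis t) * (1 - a * cnj a) = 0"
      by (simp add: algebra_simps)
    moreover have "1 - a * cnj a \<noteq> 0"
    proof -
      have "cmod (a * cnj a) < 1"
        using a by (simp add: norm_mult power2_eq_square[symmetric] abs_square_less_1)
      then show ?thesis by auto
    qed
    ultimately have "cis s = cis t" by simp
    then obtain k :: int where k: "s = t + 2 * pi * k" unfolding cis_eq_iff_int by blast
    then show "s = t" using per_int[of t k] eq by simp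
  qed
  \<comment> \<open>A decrease from \<open>s\<close> to \<open>t\<close> would be made up for later,
    as the lift gains 2 pi per period. The intermediate value theorem would then repeat the value
    \<open>\<mu> s\<close> at or beyond \<open>t\<close>, against injectivity.\<close>
  have "strict_mono \<mu>"
  proof (rule strict_monoI)
    fix s t :: real assume st: "s < t"
    show "\<mu> s < \<mu> t"
    proof (rule ccontr)
      assume "\<not> \<mu> s < \<mu> t"
      then have less: "\<mu> t < \<mu> s" using inj st by (metis injD linorder_cases less_irrefl)
      obtain k :: nat where k: "t < s + 2 * pi * k" 
        using reals_Archimedean3[of "2 * pi"]
        by (metis diff_less_eq add.commute mult.commute pi_gt_zero zero_less_mult_iff zero_less_numeral)
      define r where "r = s + 2 * pi * k"
      have "0 < 2 * pi * real k" using k st by simp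
      then have "\<mu> s \<le> \<mu> r" using per'[of s k] by (simp add: r_def)
      then have "\<exists>x\<ge>t. x \<le> r \<and> \<mu> x = \<mu> s"
        using less k by (intro IVT') (auto simp: r_def intro: continuous_on_subset[OF cont])
      then show False using inj st by (metis injD not_le)
    qed
  qed
  then have "circle_lift 1 (\<lambda>w. (w + a) / (1 + cnj a * w)) \<mu>"
    using lift cont per by (auto simp: circle_lift_def strict_mono_mono)
  then show thesis by (rule that)
qed

text \<open>Serves composition: when the inner lift advances by \<open>d\<close> turns, an outer
  lift of degree 1 advances by \<open>d\<close> turns as well.\<close>

lemma circle_lift_shift:
  assumes "circle_lift d F \<phi>"
  shows "\<phi> (t + 2 * pi * of_nat k) = \<phi> t + 2 * pi * of_nat (d * k)"
proof (induction k)
  case (Suc k)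
  have "\<phi> ((t + 2 * pi * of_nat k) + 2 * pi) = \<phi> (t + 2 * pi * of_nat k) + 2 * pi * d"
    using assms unfolding circle_lift_def by blast
  then show ?case using Suc by (simp add: algebra_simps)
qed simp

lemma circle_lift_moebius:
  assumes a: "cmod a < 1" and F: "circle_lift d F \<phi>"
  obtains \<psi> where "circle_lift d (\<lambda>z. (F z + a) / (1 + cnj a * F z)) \<psi>"
proof -
  obtain \<mu> where \<mu>: "circle_lift 1 (\<lambda>w. (w + a) / (1 + cnj a * w)) \<mu>"
    using circle_lift_moebius_ident[OF a] .
  have "continuous_on UNIV (\<mu> \<circ> \<phi>)"
    using \<mu> F unfolding circle_lift_def o_def by (blast intro: continuous_on_compose2)
  then have "circle_lift d (\<lambda>z. (F z + a) / (1 + cnj a * F z)) (\<mu> \<circ> \<phi>)"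
    using \<mu> F circle_lift_shift[OF \<mu>, of _ d]
    by (simp add: circle_lift_def mono_def strict_mono_def)
  then show thesis by (rule that)
qed

lemma circle_lift_IVT:
  assumes "circle_lift d F \<phi>" "\<phi> s < y" "y < \<phi> t"
  obtains u where "s < u" "u < t" "\<phi> u = y"
proof -
  have "s < t" using assms unfolding circle_lift_def mono_def
    by (metis less_trans not_le)
  then obtain u where u: "s \<le> u" "u \<le> t" "\<phi> u = y"
    using IVT'[of \<phi> s y t] assms
    by (auto simp: circle_lift_def intro: continuous_on_subset)
  then have "u \<noteq> s" "u \<noteq> t" using assms by auto
  then show thesis using u that by force
qed

text \<open>Over one period the lift sweeps a half-open interval of length 2 pi \<open>d\<close>
  injectively, and such an interval contains exactly \<open>d\<close> arguments of
  \<open>w\<close>.\<close>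

lemma circle_lift_card:
  assumes F: "circle_lift d F \<phi>" and "0 < d" and w: "w \<in> sphere 0 1"
  shows "finite {z \<in> sphere 0 1. F z = w}" "card {z \<in> sphere 0 1. F z = w} = d"
proof -
  have lift: "F (cis t) = cis (\<phi> t)" for t using F by (simp add: circle_lift_def)
  have mono: "strict_mono \<phi>" using F \<open>0 < d\<close> by (simp add: circle_lift_def)
  obtain \<theta>' where \<theta>': "w = cis \<theta>'" using w sphere_eq_cis by blast
  \<comment> \<open>Picks the argument of \<open>w\<close> in the first turn above
    \<open>\<phi> 0\<close>, so that the values to be hit are \<open>\<theta>\<close>,
    \<open>\<theta>\<close> + 2 pi, ... with exactly \<open>d\<close> terms.\<close>
  define k where "k = \<lceil>(\<phi> 0 - \<theta>') / (2 * pi)\<rceil>"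
  define \<theta> where "\<theta> = \<theta>' + 2 * pi * k"
  have \<theta>: "w = cis \<theta>" by (simp add: \<theta>_def \<theta>')
  have "(\<phi> 0 - \<theta>') / (2 * pi) \<le> k" "k < (\<phi> 0 - \<theta>') / (2 * pi) + 1"
    unfolding k_def by linarith+
  then have \<theta>_bounds: "\<phi> 0 \<le> \<theta>" "\<theta> < \<phi> 0 + 2 * pi"
    by (simp_all add: \<theta>_def field_simps)
  define T where "T = {t. 0 \<le> t \<and> t < 2 * pi \<and> cis (\<phi> t) = w}"
  have per: "\<phi> (2 * pi) = \<phi> 0 + 2 * pi * d"
    using F unfolding circle_lift_def by (metis add_0)
  have "\<phi> ` T = (\<lambda>j. \<theta> + 2 * pi * real j) ` {..<d}"
  proof (intro equalityI subsetI)
    fix y assume "y \<in> \<phi> ` T"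
    then obtain t where t: "0 \<le> t" "t < 2 * pi" "cis (\<phi> t) = w" "y = \<phi> t"
      by (auto simp: T_def)
    then obtain j :: int where j: "\<phi> t = \<theta> + 2 * pi * j"
      unfolding \<theta> cis_eq_iff_int by blast
    have "\<phi> 0 \<le> \<phi> t" "\<phi> t < \<phi> 0 + 2 * pi * d"
      using t mono per by (auto simp: strict_mono_less_eq strict_mono_less simp flip: per)
    then have "2 * pi * (-1) < 2 * pi * real_of_int j" "2 * pi * real_of_int j < 2 * pi * real d"
      using \<theta>_bounds j by linarith+
    then have "-1 < real_of_int j" "real_of_int j < real d"
      using two_pi_mult_less by blast+
    then have "-1 < j" "j < d" by linarith+
    then have "y = \<theta> + 2 * pi * real (nat j)" "nat j < d" using j t by auto
    then show "y \<in> (\<lambda>j. \<theta> + 2 * pi * real j) ` {..<d}" by blast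
  next
    fix y assume "y \<in> (\<lambda>j. \<theta> + 2 * pi * real j) ` {..<d}"
    then obtain j where j: "j < d" "y = \<theta> + 2 * pi * real j" by auto
    have "2 * pi * real j + 2 * pi \<le> 2 * pi * real d"
      using j mult_left_mono[of "real (Suc j)" "real d" "2 * pi"] by (simp add: algebra_simps)
    moreover have "0 \<le> 2 * pi * real j" by simp
    ultimately have y: "\<phi> 0 \<le> y" "y < \<phi> (2 * pi)" using j \<theta>_bounds per by linarith+
    have "\<exists>t\<ge>0. t \<le> 2 * pi \<and> \<phi> t = y"
      using y F by (intro IVT') (auto simp: circle_lift_def intro: continuous_on_subset)
    then obtain t where t: "0 \<le> t" "t \<le> 2 * pi" "\<phi> t = y" by blast
    moreover have "t \<noteq> 2 * pi" using t y by auto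
    moreover have "cis y = w" using cis_add_int[of \<theta> "int j"] by (simp add: j \<theta>)
    ultimately have "t \<in> T" by (auto simp: T_def)
    then show "y \<in> \<phi> ` T" using t by auto
  qed
  moreover have inj_\<phi>: "inj_on \<phi> T"
    by (rule strict_mono_imp_inj_on[OF mono])
  moreover have "inj_on (\<lambda>j. \<theta> + 2 * pi * real j) {..<d}"
    by (auto simp: inj_on_def)
  ultimately have "card T = d" by (metis card_image card_lessThan)
  moreover have fin: "finite T" using \<open>0 < d\<close> \<open>card T = d\<close> by (simp add: card_ge_0_finite)
  moreover have "inj_on cis T"
  proof (rule inj_onI)
    fix s t assume st: "s \<in> T" "t \<in> T" "cis s = cis t"
    then obtain j :: int where j: "s = t + 2 * pi * j" unfolding cis_eq_iff_int by blast
    have "0 \<le> s" "s < 2 * pi" "0 \<le> t" "t < 2 * pi" using st by (auto simp: T_def)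
    then have "2 * pi * real_of_int j < 2 * pi * 1" "2 * pi * (-1) < 2 * pi * real_of_int j"
      using j by linarith+
    then have "real_of_int j < 1" "-1 < real_of_int j"
      using two_pi_mult_less by blast+
    then have "j < 1" "-1 < j" by linarith+
    then show "s = t" using j by simp
  qed
  moreover have "{z \<in> sphere 0 1. F z = w} = cis ` T"
  proof (intro equalityI subsetI)
    fix z assume z: "z \<in> {z \<in> sphere 0 1. F z = w}"
    then obtain t where t: "0 \<le> t" "t < 2 * pi" "z = cis t"
      using sphere_eq_cis by blast
    then show "z \<in> cis ` T" using z by (auto simp: T_def lift)
  qed (auto simp: T_def lift)
  ultimately show "finite {z \<in> sphere 0 1. F z = w}" "card {z \<in> sphere 0 1. F z = w} = d"
    by (simp_all add: card_image)
qed

section \<open>Interlacing of level sets\<close>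

lemma open_arcs_cases:
  assumes "J \<in> open_arcs x y" "x \<in> Z" "y \<in> Z"
  obtains s t where "s < t" "t < s + 2 * pi" "cis s \<in> Z" "cis t \<in> Z" "J = cis ` {s<..<t}"
  using assms by (auto simp: open_arcs_def doubleton_eq_iff)

text \<open>Moves interlacing from arcs to real parameters, where the intermediate value theorem
  applies. Both orders of the end points are covered, since \<open>s\<close> and \<open>t\<close>
  range over all parameters of points of \<open>Z\<close>.\<close>

lemma open_arcs_meetI:
  assumes "\<And>s t. s < t \<Longrightarrow> t < s + 2 * pi \<Longrightarrow> cis s \<in> Z \<Longrightarrow> cis t \<in> Z \<Longrightarrow>
    \<exists>u. s < u \<and> u < t \<and> cis u \<in> X"
  shows "open_arcs_meet Z X"
  unfolding open_arcs_meet_def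
proof (intro ballI impI)
  fix x y J assume "x \<in> Z" "y \<in> Z" "J \<in> open_arcs x y"
  then obtain s t where st: "s < t" "t < s + 2 * pi" "cis s \<in> Z" "cis t \<in> Z" "J = cis ` {s<..<t}"
    using open_arcs_cases by metis
  obtain u where "s < u" "u < t" "cis u \<in> X" using assms[OF st(1-4)] by blast
  moreover have "cis u \<in> cis ` {s<..<t}" using calculation by simp
  ultimately show "J \<inter> X \<noteq> {}" using st(5) by blast
qed

text \<open>With equal cardinalities the index range of the filler points is empty. Both interlacing
  claims of the theorem are of this kind.\<close>

lemma strictly_interlaceI:
  assumes "finite Z" "finite X" "Z \<subseteq> sphere 0 1" "X \<subseteq> sphere 0 1" "1 \<le> card Z" "card Z = card X"
    "open_arcs_meet Z X" "open_arcs_meet X Z"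
  shows "strictly_interlace Z X"
  using assms by (auto simp: strictly_interlace_def)

lemma cis_lt_imp_add_2pi_le:
  assumes "cis x = cis y" "x < y"
  shows "x + 2 * pi \<le> y"
proof -
  obtain k :: int where k: "y = x + 2 * pi * k" using assms cis_eq_iff_int by metis
  then have "0 < k" using assms by (simp add: zero_less_mult_iff)
  then have "2 * pi * 1 \<le> 2 * pi * real_of_int k" by (intro mult_left_mono) auto
  then show ?thesis using k by simp
qed

text \<open>Between two solutions of \<open>F z = w\<close> the lift gains at least a full turn,
  hence passes an argument of every other point of the circle.\<close>

lemma open_arcs_meet_level_sets:
  assumes F: "circle_lift d F \<phi>" "0 < d" and w: "w \<in> sphere 0 1" "w' \<in> sphere 0 1" "w \<noteq> w'"
  shows "open_arcs_meet {z \<in> sphere 0 1. F z = w} {z \<in> sphere 0 1. F z = w'}"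
proof (rule open_arcs_meetI)
  fix s t assume st: "s < t" "cis s \<in> {z \<in> sphere 0 1. F z = w}" "cis t \<in> {z \<in> sphere 0 1. F z = w}"
  have lift: "F (cis t) = cis (\<phi> t)" for t using F by (simp add: circle_lift_def)
  have "cis (\<phi> s) = w" "cis (\<phi> t) = w" using st by (auto simp: lift)
  moreover have "\<phi> s < \<phi> t" using F st by (simp add: circle_lift_def strict_mono_less)
  ultimately have gap: "\<phi> s + 2 * pi \<le> \<phi> t" using cis_lt_imp_add_2pi_le by metis
  have "w' / w \<in> sphere 0 1" using w by (auto simp: norm_divide)
  then obtain \<theta> where \<theta>: "w' / w = cis \<theta>" "0 \<le> \<theta>" "\<theta> < 2 * pi"
    using sphere_eq_cis by blast
  then have "\<theta> \<noteq> 0" using w by auto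
  then obtain u where u: "s < u" "u < t" "\<phi> u = \<phi> s + \<theta>"
    using circle_lift_IVT[OF F(1), of s "\<phi> s + \<theta>" t] \<theta> gap by force
  then have "F (cis u) = w'"
    using \<theta>(1) \<open>cis (\<phi> s) = w\<close> w by (auto simp: lift cis_mult[symmetric] divide_simps)
  then show "\<exists>u. s < u \<and> u < t \<and> cis u \<in> {z \<in> sphere 0 1. F z = w'}" using u by auto
qed

lemma strictly_interlace_level_sets:
  assumes F: "circle_lift d F \<phi>" "0 < d" and w: "w \<in> sphere 0 1" "w' \<in> sphere 0 1" "w \<noteq> w'"
  shows "strictly_interlace {z \<in> sphere 0 1. F z = w} {z \<in> sphere 0 1. F z = w'}"
  using assms circle_lift_card[OF F] open_arcs_meet_level_sets[OF F]
  by (intro strictly_interlaceI) auto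

section \<open>Interlacing for the product of two circle maps\<close>

lemma cis_floor_interval:
  obtains k :: int where "2 * pi * k \<le> x" "x < 2 * pi * (k + 1)" "cis x = 1 \<Longrightarrow> x = 2 * pi * k"
proof -
  define k where "k = \<lfloor>x / (2 * pi)\<rfloor>"
  have "k \<le> x / (2 * pi)" "x / (2 * pi) < k + 1" unfolding k_def by linarith+
  then have "2 * pi * k \<le> x" "x < 2 * pi * (k + 1)" by (simp_all add: field_simps)
  moreover have "x = 2 * pi * k" if "cis x = 1"
  proof -
    obtain j :: int where "x = 0 + 2 * pi * j"
      using \<open>cis x = 1\<close> cis_eq_iff_int[of x 0] by auto
    then show ?thesis by (simp add: k_def)
  qed
  ultimately show thesis by (rule that)
qed

lemma cis_eq_1_ge:
  assumes "cis y = 1" "2 * pi * real_of_int k < y"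
  shows "2 * pi * (k + 1) \<le> y"
  using cis_lt_imp_add_2pi_le[of "2 * pi * real_of_int k" y] assms cis_add_int[of 0 k]
  by (simp add: algebra_simps)

text \<open>A common point of \<open>Q\<close> and \<open>R\<close> also lies in \<open>P\<close>
  and is counted once in the union. Removing it from \<open>P\<close> therefore leaves d + e - card
  (Q Int R) points on both sides.\<close>

lemma strictly_interlace_product:
  fixes F G :: "complex \<Rightarrow> complex"
  defines "P \<equiv> {z \<in> sphere 0 1. F z * G z = 1}" and "Q \<equiv> {z \<in> sphere 0 1. F z = 1}"
    and "R \<equiv> {z \<in> sphere 0 1. G z = 1}"
  assumes F: "circle_lift d F \<phi>" "0 < d" and G: "circle_lift e G \<psi>" "0 < e"
  shows "strictly_interlace (P - Q \<inter> R) (Q \<union> R)" "finite (Q \<inter> R)" "card (Q \<inter> R) \<le> min d e"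
proof -
  define \<xi> where "\<xi> t = \<phi> t + \<psi> t" for t
  have FG: "circle_lift (d + e) (\<lambda>z. F z * G z) \<xi>"
    using circle_lift_mult[OF F(1) G(1)] by (simp add: \<xi>_def[abs_def])
  have one: "(1::complex) \<in> sphere 0 1" by simp
  have lift: "F (cis t) = cis (\<phi> t)" "G (cis t) = cis (\<psi> t)" "F (cis t) * G (cis t) = cis (\<xi> t)" for t
    using F G FG by (simp_all add: circle_lift_def)
  have mono: "\<phi> s < \<phi> t" "\<psi> s < \<psi> t" "\<xi> s < \<xi> t" if "s < t" for s t
    using F G FG that by (simp_all add: circle_lift_def strict_mono_less)
  have mem: "cis t \<in> P \<longleftrightarrow> cis (\<xi> t) = 1" "cis t \<in> Q \<longleftrightarrow> cis (\<phi> t) = 1" "cis t \<in> R \<longleftrightarrow> cis (\<psi> t) = 1" for t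
    by (simp_all add: P_def Q_def R_def lift(1,2) \<xi>_def cis_mult)
  have fin: "finite P" "finite Q" "finite R" and card: "card P = d + e" "card Q = d" "card R = e"
    using circle_lift_card[OF F one] circle_lift_card[OF G one] circle_lift_card[OF FG _ one] F(2)
    by (simp_all add: P_def Q_def R_def)
  show "finite (Q \<inter> R)" using fin by simp
  have le: "card (Q \<inter> R) \<le> d" "card (Q \<inter> R) \<le> e"
    using card card_mono[of Q "Q \<inter> R"] card_mono[of R "Q \<inter> R"] fin by auto
  then show "card (Q \<inter> R) \<le> min d e" by simp
  have sub: "Q \<inter> R \<subseteq> P" by (auto simp: P_def Q_def R_def)
  have card1: "card (P - Q \<inter> R) = d + e - card (Q \<inter> R)"
    using card_Diff_subset[OF \<open>finite (Q \<inter> R)\<close> sub] card by simp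
  have card2: "card (Q \<union> R) = d + e - card (Q \<inter> R)"
    using card_Un_Int[of Q R] fin card by simp
  show "strictly_interlace (P - Q \<inter> R) (Q \<union> R)"
  proof (rule strictly_interlaceI)
    show "open_arcs_meet (P - Q \<inter> R) (Q \<union> R)"
    proof (rule open_arcs_meetI)
      fix s t assume st: "s < t" "cis s \<in> P - Q \<inter> R" "cis t \<in> P - Q \<inter> R"
      obtain j :: int where j: "2 * pi * j \<le> \<phi> s" "\<phi> s < 2 * pi * (j + 1)" "cis (\<phi> s) = 1 \<Longrightarrow> \<phi> s = 2 * pi * j"
        using cis_floor_interval[of "\<phi> s"] by blast
      obtain k :: int where k: "2 * pi * k \<le> \<psi> s" "\<psi> s < 2 * pi * (k + 1)" "cis (\<psi> s) = 1 \<Longrightarrow> \<psi> s = 2 * pi * k"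
        using cis_floor_interval[of "\<psi> s"] by blast
      show "\<exists>u. s < u \<and> u < t \<and> cis u \<in> Q \<union> R"
      proof (rule ccontr)
        assume no: "\<not> ?thesis"
        have "\<phi> t \<le> 2 * pi * (j + 1)"
        proof (rule ccontr)
          assume "\<not> \<phi> t \<le> 2 * pi * (j + 1)"
          then obtain u where u: "s < u" "u < t" "\<phi> u = 2 * pi * (j + 1)"
            using circle_lift_IVT[OF F(1), of s "2 * pi * (j + 1)" t] j by force
          then show False using no cis_add_int[of 0 "j + 1"] by (auto simp: mem)
        qed
        moreover have "\<psi> t \<le> 2 * pi * (k + 1)"
        proof (rule ccontr)
          assume "\<not> \<psi> t \<le> 2 * pi * (k + 1)"
          then obtain u where u: "s < u" "u < t" "\<psi> u = 2 * pi * (k + 1)"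
            using circle_lift_IVT[OF G(1), of s "2 * pi * (k + 1)" t] k by force
          then show False using no cis_add_int[of 0 "k + 1"] by (auto simp: mem)
        qed
        moreover have "\<xi> s + 2 * pi \<le> \<xi> t"
          using st mono(3)[OF st(1)] by (intro cis_lt_imp_add_2pi_le) (auto simp: mem)
        \<comment> \<open>\<open>\<xi> s\<close> is a multiple of 2 pi. The smallest value allowed
          by the two lower bounds would put both phases at their left ends, that is
          \<open>cis s\<close> into \<open>Q \<inter> R\<close>, so the next multiple is
          reached.\<close>
        moreover have "2 * pi * (j + k + 1) \<le> \<xi> s"
        proof -
          have "\<xi> s \<noteq> 2 * pi * (j + k)"
          proof
            assume "\<xi> s = 2 * pi * (j + k)"
            then have "\<phi> s = 2 * pi * j" "\<psi> s = 2 * pi * k"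
              using j k by (simp_all add: \<xi>_def algebra_simps)
            then show False using st cis_add_int[of 0 j] cis_add_int[of 0 k] by (auto simp: mem)
          qed
          moreover have "2 * pi * real_of_int (j + k) \<le> \<xi> s"
            using j k by (simp add: \<xi>_def algebra_simps)
          ultimately show ?thesis using cis_eq_1_ge[of "\<xi> s" "j + k"] st by (simp add: mem)
        qed
        \<comment> \<open>Now \<open>\<xi> t\<close> is at least the sum of the upper bounds for
          \<open>\<phi> t\<close> and \<open>\<psi> t\<close>, so both bounds are attained.\<close>
        ultimately have "\<phi> t = 2 * pi * (j + 1)" "\<psi> t = 2 * pi * (k + 1)"
          by (simp_all add: \<xi>_def algebra_simps)
        then have "cis t \<in> Q \<inter> R"
          using cis_add_int[of 0 "j + 1"] cis_add_int[of 0 "k + 1"] by (simp add: mem)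
        then show False using st by simp
      qed
    qed
    show "open_arcs_meet (Q \<union> R) (P - Q \<inter> R)"
    proof (rule open_arcs_meetI)
      fix s t assume st: "s < t" "cis s \<in> Q \<union> R" "cis t \<in> Q \<union> R"
      obtain j :: int where j: "2 * pi * j \<le> \<phi> s" "\<phi> s < 2 * pi * (j + 1)" "cis (\<phi> s) = 1 \<Longrightarrow> \<phi> s = 2 * pi * j"
        using cis_floor_interval[of "\<phi> s"] by blast
      obtain k :: int where k: "2 * pi * k \<le> \<psi> s" "\<psi> s < 2 * pi * (k + 1)" "cis (\<psi> s) = 1 \<Longrightarrow> \<psi> s = 2 * pi * k"
        using cis_floor_interval[of "\<psi> s"] by blast
      \<comment> \<open>One of the two phases sits at the left end of its interval at
        \<open>s\<close>, and the other is still below its right end. By \<open>t\<close> one phase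
        has completed its turn and the other has strictly increased.\<close>
      have "\<xi> s < 2 * pi * (j + k + 1)"
        using st j k by (auto simp: mem \<xi>_def algebra_simps)
      moreover have "2 * pi * (j + k + 1) < \<xi> t"
        using st j(1) k(1) mono[OF st(1)] cis_eq_1_ge[of "\<phi> t" j] cis_eq_1_ge[of "\<psi> t" k]
        by (auto simp: mem \<xi>_def algebra_simps)
      ultimately obtain u where u: "s < u" "u < t" "\<xi> u = 2 * pi * (j + k + 1)"
        using circle_lift_IVT[OF FG] by blast
      have "cis u \<in> P" using u cis_add_int[of 0 "j + k + 1"] by (simp add: mem)
      \<comment> \<open>At a common point both phases would have completed their turns, which puts
        \<open>\<xi> u\<close> one turn too high.\<close>
      moreover have "cis u \<notin> Q \<inter> R"
      proof
        assume "cis u \<in> Q \<inter> R"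
        then have "2 * pi * (j + 1) \<le> \<phi> u" "2 * pi * (k + 1) \<le> \<psi> u"
          using cis_eq_1_ge[of "\<phi> u" j] cis_eq_1_ge[of "\<psi> u" k] mono[OF u(1)] j(1) k(1)
          by (simp_all add: mem)
        then show False using u(3) pi_gt_zero by (simp add: \<xi>_def algebra_simps)
      qed
      ultimately show "\<exists>u. s < u \<and> u < t \<and> cis u \<in> P - Q \<inter> R" using u by auto
    qed
  qed (use fin card1 card2 le F(2) in \<open>auto simp: P_def Q_def R_def\<close>)
qed

section \<open>Action of the block factors on vectors\<close>

text \<open>Removing the first entry exchanges even and odd positions. This turns the parity-based
  factors into recursive ones.\<close>

lemma filter_parity_shift:
  "map f (filter even [0..<Suc n]) = f 0 # map (\<lambda>j. f (Suc j)) (filter odd [0..<n])"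
  "map f (filter odd [0..<Suc n]) = map (\<lambda>j. f (Suc j)) (filter even [0..<n])"
  by (simp_all del: upt_Suc add: upt_conv_Cons map_Suc_upt[symmetric] filter_map o_def)

lemma diag_block_mat_Cons_pair:
  "diag_block_mat (A # Bs) = diag_block_mat [A, diag_block_mat Bs]"
  by (simp only: diag_block_mat.simps(2)[of A] diag_block_mat_singleton)

lemma cmv_L_rec:
  "cmv_L [] b = const_mat1 (cnj b)"
  "cmv_L [a] b = Theta a"
  "cmv_L (a # a' # as) b = diag_block_mat [Theta a, cmv_L as b]"
proof -
  show "cmv_L [] b = const_mat1 (cnj b)" "cmv_L [a] b = Theta a"
    by (simp_all add: cmv_L_def del: diag_block_mat.simps)
  show "cmv_L (a # a' # as) b = diag_block_mat [Theta a, cmv_L as b]"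
    by (simp del: upt_Suc diag_block_mat.simps
        add: cmv_L_def filter_parity_shift diag_block_mat_Cons_pair[symmetric])
qed

text \<open>After its leading 1 the right factor is the left factor of the array without its first
  entry, the trailing block included. Facts about \<open>cmv_M\<close> thus reduce to facts about
  \<open>cmv_L\<close>.\<close>

lemma cmv_M_rec:
  "cmv_M [] b = const_mat1 1"
  "cmv_M (a # as) b = diag_block_mat [const_mat1 1, cmv_L as b]"
  by (simp_all del: upt_Suc diag_block_mat.simps
      add: cmv_M_def cmv_L_def filter_parity_shift diag_block_mat_Cons_pair[symmetric])

section \<open>Orders of the blocks and factors\<close>

lemma const_mat1_carrier: "const_mat1 c \<in> carrier_mat 1 1"
  by (simp add: const_mat1_def)

lemma Theta_carrier: "Theta a \<in> carrier_mat 2 2"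
  by (rule carrier_matI) (simp_all add: Theta_def mat_of_rows_list_def Let_def)

lemma diag_block_mat_pair:
  assumes "A \<in> carrier_mat n n" "B \<in> carrier_mat m m"
  shows "diag_block_mat [A, B] = four_block_mat A (0\<^sub>m n m) (0\<^sub>m m n) B"
  unfolding diag_block_mat.simps(2)[of A] diag_block_mat_singleton Let_def
  using assms by (metis carrier_matD)

lemma diag_block_mat_pair_carrier:
  assumes "A \<in> carrier_mat n n" "B \<in> carrier_mat m m"
  shows "diag_block_mat [A, B] \<in> carrier_mat (n + m) (n + m)"
  unfolding diag_block_mat_pair[OF assms] by (rule four_block_carrier_mat[OF assms])

lemma cmv_L_carrier: "cmv_L as b \<in> carrier_mat (Suc (length as)) (Suc (length as))"
proof (induction as rule: induct_list012)
  case 1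
  show ?case using const_mat1_carrier[of "cnj b"] by (simp add: cmv_L_rec(1))
next
  case (2 a)
  show ?case using Theta_carrier[of a] by (simp add: cmv_L_rec(2) numeral_2_eq_2)
next
  case (3 a a' as)
  show ?case
    using diag_block_mat_pair_carrier[OF Theta_carrier[of a] 3(1)]
    by (simp add: cmv_L_rec(3) del: diag_block_mat.simps)
qed

lemma cmv_M_carrier: "cmv_M as b \<in> carrier_mat (Suc (length as)) (Suc (length as))"
proof (cases as)
  case Nil
  then show ?thesis using const_mat1_carrier[of 1] by (simp add: cmv_M_rec(1))
next
  case (Cons a as')
  then show ?thesis
    using diag_block_mat_pair_carrier[OF const_mat1_carrier[of 1] cmv_L_carrier[of as' b]]
    by (simp add: cmv_M_rec(2) del: diag_block_mat.simps)
qed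

section \<open>Entrywise criteria for the action on vectors\<close>

lemma diag_block_mat_pair_mult_vec:
  assumes A: "A \<in> carrier_mat n n" "A *\<^sub>v Matrix.vec n u = Matrix.vec n v"
    and B: "B \<in> carrier_mat m m"
      "B *\<^sub>v Matrix.vec m (\<lambda>i. u (n + i)) = Matrix.vec m (\<lambda>i. v (n + i))"
  shows "diag_block_mat [A, B] *\<^sub>v Matrix.vec (n + m) u = Matrix.vec (n + m) v"
proof -
  have split: "Matrix.vec (n + m) w = Matrix.vec n w @\<^sub>v Matrix.vec m (\<lambda>i. w (n + i))" for w :: "nat \<Rightarrow> 'a"
    by (rule eq_vecI) auto
  have "diag_block_mat [A, B] *\<^sub>v (Matrix.vec n u @\<^sub>v Matrix.vec m (\<lambda>i. u (n + i))) =
      A *\<^sub>v Matrix.vec n u @\<^sub>v B *\<^sub>v Matrix.vec m (\<lambda>i. u (n + i))"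
    unfolding diag_block_mat_pair[OF A(1) B(1)]
    by (rule mult_mat_vec_split[OF A(1) B(1)]) auto
  then show ?thesis unfolding split A(2) B(2) .
qed

lemma const_mat1_mult_vec: "const_mat1 c *\<^sub>v Matrix.vec (Suc 0) u = Matrix.vec (Suc 0) (\<lambda>i. c * u i)"
  by (rule eq_vecI) (auto simp: const_mat1_def scalar_prod_def)

abbreviation rho :: "complex \<Rightarrow> complex" where
  "rho a \<equiv> complex_of_real (sqrt (1 - (cmod a)\<^sup>2))"

definition Theta_maps :: "complex \<Rightarrow> complex \<Rightarrow> complex \<Rightarrow> complex \<Rightarrow> complex \<Rightarrow> bool" where
  "Theta_maps a u u' v v' \<longleftrightarrow> cnj a * u + rho a * u' = v \<and> rho a * u - a * u' = v'"

lemma Theta_mult_vec: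
  assumes "Theta_maps a (u 0) (u 1) (v 0) (v 1)"
  shows "Theta a *\<^sub>v Matrix.vec 2 u = Matrix.vec 2 v"
proof (rule eq_vecI)
  fix i assume "i < dim_vec (Matrix.vec 2 v)"
  then have "i = 0 \<or> i = 1" by auto
  then show "vec_index (Theta a *\<^sub>v Matrix.vec 2 u) i = vec_index (Matrix.vec 2 v) i"
    using assms
    by (auto simp: Theta_def Theta_maps_def mat_of_rows_list_def scalar_prod_def numeral_2_eq_2 Let_def)
qed (use Theta_carrier[of a] in simp)

text \<open>The pairs (j, j + 1) with even j tile the indices, except that the last index is left to
  the block \<open>cnj b\<close> when the length is even.\<close>

lemma cmv_L_mult_vec:
  assumes "\<And>j. j < length as \<Longrightarrow> even j \<Longrightarrow> Theta_maps (as ! j) (u j) (u (Suc j)) (v j) (v (Suc j))"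
    and "even (length as) \<Longrightarrow> cnj b * u (length as) = v (length as)"
  shows "cmv_L as b *\<^sub>v Matrix.vec (Suc (length as)) u = Matrix.vec (Suc (length as)) v"
  using assms
proof (induction as arbitrary: u v rule: induct_list012)
  case 1
  then show ?case by (auto simp: cmv_L_rec const_mat1_mult_vec intro!: eq_vecI)
next
  case (2 a)
  then show ?case using Theta_mult_vec[of a u v] by (simp add: cmv_L_rec numeral_2_eq_2)
next
  case (3 a a' as)
  have "Theta a *\<^sub>v Matrix.vec 2 u = Matrix.vec 2 v"
    using 3(3)[of 0] by (intro Theta_mult_vec) simp
  moreover have "cmv_L as b *\<^sub>v Matrix.vec (Suc (length as)) (\<lambda>i. u (2 + i)) =
      Matrix.vec (Suc (length as)) (\<lambda>i. v (2 + i))"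
  proof (rule 3(1))
    fix j assume "j < length as" "even j"
    then show "Theta_maps (as ! j) (u (2 + j)) (u (2 + Suc j)) (v (2 + j)) (v (2 + Suc j))"
      using 3(3)[of "2 + j"] by simp
  qed (use 3(4) in simp)
  ultimately show ?case
    using diag_block_mat_pair_mult_vec[OF Theta_carrier _ cmv_L_carrier]
    by (simp add: cmv_L_rec(3) del: diag_block_mat.simps)
qed

lemma cmv_M_mult_vec:
  assumes "\<And>j. j < length as \<Longrightarrow> odd j \<Longrightarrow> Theta_maps (as ! j) (u j) (u (Suc j)) (v j) (v (Suc j))"
    and "odd (length as) \<Longrightarrow> cnj b * u (length as) = v (length as)" and "u 0 = v 0"
  shows "cmv_M as b *\<^sub>v Matrix.vec (Suc (length as)) u = Matrix.vec (Suc (length as)) v"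
proof (cases as)
  case Nil
  then show ?thesis using assms by (auto simp: cmv_M_rec const_mat1_mult_vec intro!: eq_vecI)
next
  case (Cons a as')
  have "const_mat1 1 *\<^sub>v Matrix.vec 1 u = Matrix.vec 1 v"
    using assms(3) by (auto simp: const_mat1_mult_vec intro!: eq_vecI)
  moreover have "cmv_L as' b *\<^sub>v Matrix.vec (Suc (length as')) (\<lambda>i. u (1 + i)) =
      Matrix.vec (Suc (length as')) (\<lambda>i. v (1 + i))"
  proof (rule cmv_L_mult_vec)
    fix j assume "j < length as'" "even j"
    then show "Theta_maps (as' ! j) (u (1 + j)) (u (1 + Suc j)) (v (1 + j)) (v (1 + Suc j))"
      using assms(1)[of "1 + j"] Cons by simp
  qed (use assms(2) Cons in simp)
  ultimately show ?thesis
    using diag_block_mat_pair_mult_vec[OF const_mat1_carrier _ cmv_L_carrier]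
    by (simp add: cmv_M_rec(2) Cons del: diag_block_mat.simps)
qed

text \<open>With \<open>f = (a + \<zeta> f') / (1 + cnj a \<zeta> f')\<close>, this single step produces both the \<open>cmv_L\<close>
  and the \<open>cmv_M\<close> part of the eigenvector equation.\<close>

lemma Theta_maps_schur_step:
  fixes q :: complex
  assumes a: "cmod a < 1" and f: "\<zeta> * f' * (1 - cnj a * f) = f - a"
  defines "r \<equiv> q * (1 - cnj a * f) / rho a"
  shows "Theta_maps a (f * q) r q (\<zeta> * f' * r)"
proof -
  have "0 < 1 - (cmod a)\<^sup>2" using a by (simp add: power_less_one_iff abs_square_less_1)
  then have nz: "rho a \<noteq> 0" and "(sqrt (1 - (cmod a)\<^sup>2))\<^sup>2 = 1 - (cmod a)\<^sup>2" by simp_all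
  then have sq: "rho a * rho a = 1 - a * cnj a"
    unfolding power2_eq_square[symmetric] of_real_power[symmetric] complex_norm_square[symmetric]
    by simp
  have rho_r: "rho a * r = q * (1 - cnj a * f)" using nz by (simp add: r_def)
  have "cnj a * (f * q) + rho a * r = q"
    unfolding rho_r by (simp add: algebra_simps)
  moreover have "rho a * (f * q) - a * r = \<zeta> * f' * r"
  proof -
    \<comment> \<open>The factor \<open>rho a\<close> is nonzero and can be cancelled afterwards; it
      makes both \<open>sq\<close> and \<open>rho_r\<close> applicable.\<close>
    have "rho a * (rho a * (f * q) - a * r) = rho a * rho a * (f * q) - a * (rho a * r)"
      by (simp add: algebra_simps)
    also have "\<dots> = (1 - a * cnj a) * (f * q) - a * (q * (1 - cnj a * f))"
      unfolding sq rho_r by simp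
    also have "\<dots> = q * (f - a)" by (simp add: algebra_simps)
    also have "\<dots> = rho a * (\<zeta> * f' * r)" using nz by (simp add: f[symmetric] r_def)
    finally show ?thesis using nz by simp
  qed
  ultimately show ?thesis by (simp add: Theta_maps_def)
qed

section \<open>The Schur recursion on the circle\<close>

lemma moebius_unimodular:
  assumes "cmod a < 1" "cmod w = 1"
  shows "cmod ((w + a) / (1 + cnj a * w)) = 1"
proof -
  obtain \<mu> where \<mu>: "circle_lift 1 (\<lambda>w. (w + a) / (1 + cnj a * w)) \<mu>"
    using circle_lift_moebius_ident[OF assms(1)] .
  obtain t where "w = cis t" using assms sphere_eq_cis[of w] by auto
  then show ?thesis using \<mu> by (simp add: circle_lift_def)
qed

text \<open>Multiplying numerator and denominator by \<open>\<zeta>\<close>, the inverse of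
  \<open>cnj \<zeta>\<close> on the circle, exhibits the Moebius form to which the lifts
  apply.\<close>

lemma back_rec_Cons:
  assumes "cmod \<zeta> = 1"
  shows "back_rec \<zeta> (a # as) b =
    (\<zeta> * back_rec \<zeta> as b + a) / (1 + cnj a * (\<zeta> * back_rec \<zeta> as b))"
proof -
  have nz: "\<zeta> \<noteq> 0" and inv: "cnj \<zeta> = 1 / \<zeta>"
    using assms cnj_eq_inverse[OF assms] by (auto simp: divide_inverse)
  define w where "w = back_rec \<zeta> as b"
  have "back_rec \<zeta> (a # as) b = (a / \<zeta> + w) / (cnj a * w + 1 / \<zeta>)"
    by (simp add: w_def inv)
  also have "\<dots> = (\<zeta> * (a / \<zeta> + w)) / (\<zeta> * (cnj a * w + 1 / \<zeta>))"
    using nz by simp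
  also have "\<dots> = (\<zeta> * w + a) / (1 + cnj a * (\<zeta> * w))"
    using nz by (simp add: distrib_left ac_simps)
  finally show ?thesis by (simp add: w_def)
qed

lemma back_rec_unimodular:
  assumes "cmod \<zeta> = 1" "\<forall>a\<in>set as. cmod a < 1" "cmod b = 1"
  shows "cmod (back_rec \<zeta> as b) = 1"
  using assms(2)
proof (induction as)
  case (Cons a as)
  then show ?case
    using moebius_unimodular[of a "\<zeta> * back_rec \<zeta> as b"] assms(1)
    by (simp add: back_rec_Cons norm_mult del: back_rec.simps)
qed (use assms in simp)

lemma back_rec_append: "back_rec \<zeta> (as @ bs) b = back_rec \<zeta> as (back_rec \<zeta> bs b)"
  by (induction as) simp_all

text \<open>The factor \<open>\<beta>\<close> cancels in the denominator and comes out of the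
  numerator. Rotating the tail of the array therefore only moves the level at which the spectrum is
  taken.\<close>

lemma back_rec_rotate:
  assumes "cmod \<beta> = 1"
  shows "back_rec \<zeta> (map ((*) \<beta>) as) (\<beta> * b) = \<beta> * back_rec \<zeta> as b"
proof (induction as)
  case (Cons a as)
  then show ?case using cnj_unimodular[OF assms] by (simp add: algebra_simps)
qed simp

text \<open>Each entry contributes one factor \<open>\<zeta>\<close>, of degree 1, and the Moebius
  map preserves the degree.\<close>

lemma circle_lift_back_rec:
  assumes "\<forall>a\<in>set as. cmod a < 1" "cmod b = 1"
  shows "\<exists>\<phi>. circle_lift (length as) (\<lambda>\<zeta>. back_rec \<zeta> as b) \<phi>"
  using assms(1)
proof (induction as)
  case Nil
  obtain s where "b = cis s" using assms(2) sphere_eq_cis[of b] by auto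
  then show ?case using circle_lift_const by auto
next
  case (Cons a as)
  then obtain \<phi> where \<phi>: "circle_lift (length as) (\<lambda>\<zeta>. back_rec \<zeta> as b) \<phi>" by auto
  have "cmod a < 1" using Cons.prems by simp
  from circle_lift_moebius[OF this circle_lift_mult[OF circle_lift_ident \<phi>]]
  obtain \<psi> where "circle_lift (1 + length as) (\<lambda>\<zeta>. (\<zeta> * back_rec \<zeta> as b + a) /
      (1 + cnj a * (\<zeta> * back_rec \<zeta> as b))) \<psi>"
    by blast
  then have "circle_lift (length (a # as)) (\<lambda>\<zeta>. back_rec \<zeta> (a # as) b) \<psi>"
    by (simp add: circle_lift_def back_rec_Cons del: back_rec.simps)
  then show ?case by blast
qed

text \<open>Solves \<open>G * back_rec \<zeta> as w = 1\<close> for \<open>w\<close>, as \<open>1 / fwd_rec \<zeta> as G\<close>.  For \<open>G = \<zeta>\<close> this is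
  \<open>\<zeta> \<Phi>(\<zeta>) / \<Phi>\<^sup>*(\<zeta>)\<close> with \<open>\<Phi>\<close> the monic orthogonal polynomial of the array \<open>as\<close>.\<close>

primrec fwd_rec :: "complex \<Rightarrow> complex list \<Rightarrow> complex \<Rightarrow> complex" where
  "fwd_rec \<zeta> [] G = G"
| "fwd_rec \<zeta> (a # as) G = fwd_rec \<zeta> as (\<zeta> * ((G - cnj a) / (1 - a * G)))"

lemma circle_lift_fwd_rec:
  assumes "\<forall>a\<in>set as. cmod a < 1" "circle_lift d H \<phi>"
  shows "\<exists>\<psi>. circle_lift (d + length as) (\<lambda>\<zeta>. fwd_rec \<zeta> as (H \<zeta>)) \<psi>"
  using assms
proof (induction as arbitrary: d H \<phi>)
  case (Cons a as)
  obtain \<psi> where "circle_lift d (\<lambda>z. (H z - cnj a) / (1 - a * H z)) \<psi>"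
    using circle_lift_moebius[of "- cnj a" d H \<phi>] Cons.prems by auto
  from Cons.IH[OF _ circle_lift_mult[OF circle_lift_ident this]] Cons.prems
  show ?case by simp
qed auto

lemma back_rec_eq_iff_fwd_rec_eq:
  assumes "cmod \<zeta> = 1" "\<forall>a\<in>set as. cmod a < 1" "cmod w = 1" "cmod G = 1"
  shows "G * back_rec \<zeta> as w = 1 \<longleftrightarrow> fwd_rec \<zeta> as G * w = 1"
  using assms(2,4)
proof (induction as arbitrary: G)
  case (Cons a as)
  define f where "f = back_rec \<zeta> as w"
  define G' where "G' = \<zeta> * ((G - cnj a) / (1 - a * G))"
  have a: "cmod a < 1" and as: "\<forall>a\<in>set as. cmod a < 1" using Cons.prems by auto
  have "cmod (\<zeta> * f) = 1"
    using back_rec_unimodular[OF assms(1) as assms(3)] assms(1) by (simp add: f_def norm_mult)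
  then have nz: "1 + cnj a * (\<zeta> * f) \<noteq> 0" "1 - a * G \<noteq> 0"
    using moebius_denominator_nonzero[OF a] Cons.prems(2) by auto
  have G': "cmod G' = 1"
    unfolding G'_def norm_mult using moebius_unimodular[of "- cnj a" G] a Cons.prems(2) assms(1)
    by simp
  have "G * back_rec \<zeta> (a # as) w = 1 \<longleftrightarrow> G * (\<zeta> * f + a) = 1 + cnj a * (\<zeta> * f)"
    using nz by (simp add: back_rec_Cons[OF assms(1)] f_def[symmetric] divide_eq_eq del: back_rec.simps)
  \<comment> \<open>The cleared equation is linear in \<open>f\<close>; collecting its terms peels
    off one entry and passes \<open>G'\<close> on to the rest.\<close>
  also have "\<dots> \<longleftrightarrow> \<zeta> * (G - cnj a) * f = 1 - a * G"
    by (auto simp: algebra_simps)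
  also have "\<dots> \<longleftrightarrow> G' * f = 1" using nz by (simp add: G'_def divide_eq_eq)
  also have "\<dots> \<longleftrightarrow> fwd_rec \<zeta> (a # as) G * w = 1"
    using Cons.IH[OF as G'] by (simp add: f_def G'_def)
  finally show ?case .
qed simp

section \<open>Spectra of CMV matrices\<close>

text \<open>Amplitude of the solution of \<open>M D x = y\<close>, \<open>L y = \<zeta> x\<close>: the ratio of the two vectors at
  position \<open>j\<close> is prescribed by \<open>back_rec \<zeta> (drop j as) b\<close>, in alternating orientation.\<close>

primrec amplitude :: "complex \<Rightarrow> complex list \<Rightarrow> complex \<Rightarrow> nat \<Rightarrow> complex" where
  "amplitude \<zeta> as b 0 = 1"
| "amplitude \<zeta> as b (Suc j) = (if odd j then \<zeta> else 1) *
     (amplitude \<zeta> as b j * (1 - cnj (as ! j) * back_rec \<zeta> (drop j as) b) / rho (as ! j))"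

text \<open>The recursion makes every \<open>Theta\<close> block match, and its end value
  \<open>b\<close> matches the block \<open>cnj b\<close>. The hypothesis on \<open>\<gamma>\<close>
  is what remains at index 0, where the right factor has the block 1.\<close>

lemma eigenvalue_cmv_mult_diag:
  assumes \<zeta>: "cmod \<zeta> = 1" and as: "\<forall>a\<in>set as. cmod a < 1" and b: "cmod b = 1"
    and eq: "\<zeta> * back_rec \<zeta> as b = \<gamma>"
  shows "eigenvalue (cmv as b * diag_block_mat [const_mat1 \<gamma>, 1\<^sub>m (length as)]) \<zeta>"
proof -
  define n where "n = length as"
  define D where "D = diag_block_mat [const_mat1 \<gamma>, 1\<^sub>m n]"
  define f where "f j = back_rec \<zeta> (drop j as) b" for j
  define q where "q = amplitude \<zeta> as b"
  \<comment> \<open>\<open>x\<close> is the eigenvector, \<open>x'\<close> its image under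
    \<open>D\<close>, and \<open>y\<close> the image of \<open>x'\<close> under the right factor.
    The roles of \<open>q j\<close> and \<open>f j * q j\<close> alternate since blocks start at
    even indices in one factor and at odd indices in the other.\<close>
  define x where "x j = (if even j then q j / \<zeta> else f j * q j)" for j
  define y where "y j = (if even j then f j * q j else q j)" for j
  define x' where "x' = (\<lambda>j. if j = 0 then \<gamma> * x 0 else x j)"
  have nz: "\<zeta> \<noteq> 0" using \<zeta> by auto
  have step: "Theta_maps (as ! j) (f j * q j) r (q j) (\<zeta> * f (Suc j) * r)"
    if "j < n" "r = q j * (1 - cnj (as ! j) * f j) / rho (as ! j)" for j r
  proof -
    have a: "cmod (as ! j) < 1" using as that by (simp add: n_def)
    have drop: "drop j as = as ! j # drop (Suc j) as"
      using that by (simp add: n_def Cons_nth_drop_Suc)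
    have "\<forall>a\<in>set (drop (Suc j) as). cmod a < 1" using as by (auto dest: in_set_dropD)
    then have "cmod (\<zeta> * f (Suc j)) = 1"
      using back_rec_unimodular[OF \<zeta> _ b] \<zeta> by (simp add: f_def norm_mult)
    then have "1 + cnj (as ! j) * (\<zeta> * f (Suc j)) \<noteq> 0"
      using moebius_denominator_nonzero[OF a] by blast
    then have "f j * (1 + cnj (as ! j) * (\<zeta> * f (Suc j))) = \<zeta> * f (Suc j) + as ! j"
      by (simp add: f_def drop back_rec_Cons[OF \<zeta>] del: back_rec.simps)
    then have "\<zeta> * f (Suc j) * (1 - cnj (as ! j) * f j) = f j - as ! j"
      by (simp add: algebra_simps)
    from Theta_maps_schur_step[OF a this] show ?thesis using that by simp
  qed
  have q_Suc: "q (Suc j) = (if odd j then \<zeta> else 1) * (q j * (1 - cnj (as ! j) * f j) / rho (as ! j))" for j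
    by (simp add: q_def f_def)
  have f_n: "f n = b" by (simp add: f_def n_def)
  have L: "cmv_L as b *\<^sub>v Matrix.vec (Suc n) y = Matrix.vec (Suc n) (\<lambda>j. \<zeta> * x j)"
    unfolding n_def
  proof (rule cmv_L_mult_vec)
    fix j assume j: "j < length as" "even j"
    define r where "r = q j * (1 - cnj (as ! j) * f j) / rho (as ! j)"
    have "q (Suc j) = r" using j by (simp add: q_Suc r_def)
    then show "Theta_maps (as ! j) (y j) (y (Suc j)) (\<zeta> * x j) (\<zeta> * x (Suc j))"
      using step[OF _ r_def] j nz by (simp add: n_def x_def y_def ac_simps)
  qed (use nz f_n cnj_unimodular[OF b] in \<open>simp add: x_def y_def n_def[symmetric] mult.assoc[symmetric]\<close>)
  have M: "cmv_M as b *\<^sub>v Matrix.vec (Suc n) x' = Matrix.vec (Suc n) y"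
    unfolding n_def
  proof (rule cmv_M_mult_vec)
    fix j assume j: "j < length as" "odd j"
    define r where "r = q j * (1 - cnj (as ! j) * f j) / rho (as ! j)"
    \<comment> \<open>The extra \<open>\<zeta>\<close> at odd steps of the amplitude compensates the
      division by \<open>\<zeta>\<close> in \<open>x\<close> at the following even index.\<close>
    have "q (Suc j) = \<zeta> * r" using j by (simp add: q_Suc r_def)
    moreover have "j \<noteq> 0" using j by (metis even_zero)
    ultimately show "Theta_maps (as ! j) (x' j) (x' (Suc j)) (y j) (y (Suc j))"
      using step[OF _ r_def] j nz by (simp add: n_def x_def x'_def y_def ac_simps)
  next
    assume "odd (length as)"
    then show "cnj b * x' (length as) = y (length as)"
      using f_n cnj_unimodular[OF b]
      by (auto simp: x'_def x_def y_def n_def[symmetric] mult.assoc[symmetric])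
  next
    show "x' 0 = y 0" using eq nz by (auto simp: x'_def x_def y_def f_def q_def)
  qed
  have D: "D *\<^sub>v Matrix.vec (Suc n) x = Matrix.vec (Suc n) x'"
  proof -
    have "const_mat1 \<gamma> *\<^sub>v Matrix.vec 1 x = Matrix.vec 1 x'"
      by (auto simp: const_mat1_mult_vec x'_def intro!: eq_vecI)
    moreover have "1\<^sub>m n *\<^sub>v Matrix.vec n (\<lambda>i. x (1 + i)) = Matrix.vec n (\<lambda>i. x' (1 + i))"
      by (simp add: x'_def)
    ultimately show ?thesis
      using diag_block_mat_pair_mult_vec[OF const_mat1_carrier, of \<gamma> x x' "1\<^sub>m n" n]
      by (simp add: D_def del: diag_block_mat.simps)
  qed
  have carrier: "cmv_L as b \<in> carrier_mat (Suc n) (Suc n)" "cmv_M as b \<in> carrier_mat (Suc n) (Suc n)"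
    "D \<in> carrier_mat (Suc n) (Suc n)"
    using cmv_L_carrier[of as b] cmv_M_carrier[of as b]
      diag_block_mat_pair_carrier[OF const_mat1_carrier one_carrier_mat[of n]]
    by (simp_all add: n_def D_def del: diag_block_mat.simps)
  let ?x = "Matrix.vec (Suc n) x"
  have "cmv as b * D *\<^sub>v ?x = cmv_L as b *\<^sub>v (cmv_M as b *\<^sub>v (D *\<^sub>v ?x))"
    unfolding cmv_def using carrier
    by (subst assoc_mult_mat_vec, (auto intro: mult_carrier_mat mult_mat_vec_carrier)[3])+ simp
  also have "\<dots> = \<zeta> \<cdot>\<^sub>v ?x" unfolding D M L by (rule eq_vecI) auto
  finally have "cmv as b * D *\<^sub>v ?x = \<zeta> \<cdot>\<^sub>v ?x" .
  moreover have "?x \<noteq> 0\<^sub>v (Suc n)"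
  proof
    assume "?x = 0\<^sub>v (Suc n)"
    then have "vec_index ?x 0 = vec_index (0\<^sub>v (Suc n)) 0" by simp
    then show False using nz by (simp add: x_def q_def)
  qed
  moreover have "dim_row (cmv as b * D) = Suc n" using carrier by (simp add: cmv_def)
  ultimately have "eigenvalue (cmv as b * D) \<zeta>"
    unfolding eigenvalue_def eigenvector_def by (intro exI[of _ ?x]) simp
  then show ?thesis by (simp only: D_def n_def)
qed

text \<open>The eigenvectors above already account for \<open>length as + 1\<close> eigenvalues, so there are no
  others.\<close>

theorem spectrum_cmv_mult_diag:
  assumes as: "\<forall>a\<in>set as. cmod a < 1" and b: "cmod b = 1" and \<gamma>: "cmod \<gamma> = 1"
  shows "spectrum (cmv as b * diag_block_mat [const_mat1 \<gamma>, 1\<^sub>m (length as)]) =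
    {\<zeta> \<in> sphere 0 1. \<zeta> * back_rec \<zeta> as b = \<gamma>}" (is "spectrum ?N = ?S")
proof -
  obtain \<phi> where "circle_lift (length as) (\<lambda>\<zeta>. back_rec \<zeta> as b) \<phi>"
    using circle_lift_back_rec[OF as b] by blast
  from circle_lift_card(2)[OF circle_lift_mult[OF circle_lift_ident this]]
  have card: "card ?S = Suc (length as)" using \<gamma> by simp
  have "?N \<in> carrier_mat (Suc (length as)) (Suc (length as))"
    using mult_carrier_mat[OF mult_carrier_mat[OF cmv_L_carrier cmv_M_carrier]]
      diag_block_mat_pair_carrier[OF const_mat1_carrier one_carrier_mat[of "length as"]]
    by (simp add: cmv_def del: diag_block_mat.simps)
  note spec = card_finite_spectrum[OF this]
  have "?S \<subseteq> spectrum ?N"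
    using eigenvalue_cmv_mult_diag[OF _ as b] by (auto simp: spectrum_def)
  then show ?thesis using card_seteq[OF spec(1)] spec(2) card by metis
qed

corollary spectrum_cmv:
  assumes as: "\<forall>a\<in>set as. cmod a < 1" and b: "cmod b = 1"
  shows "spectrum (cmv as b) = {\<zeta> \<in> sphere 0 1. \<zeta> * back_rec \<zeta> as b = 1}"
proof -
  have "diag_block_mat [const_mat1 1, 1\<^sub>m (length as)] = 1\<^sub>m (Suc (length as))"
    by (rule eq_matI) (auto simp: const_mat1_def Let_def)
  moreover have "cmv as b \<in> carrier_mat (Suc (length as)) (Suc (length as))"
    unfolding cmv_def by (rule mult_carrier_mat[OF cmv_L_carrier cmv_M_carrier])
  ultimately show ?thesis
    using spectrum_cmv_mult_diag[OF as b, of 1] by (simp del: diag_block_mat.simps)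
qed

text \<open>Separates the variables: the first factor depends on \<open>as\<close> only, the second
  on \<open>bs\<close> and \<open>b\<close> only.\<close>

corollary spectrum_cmv_append:
  assumes as: "\<forall>a\<in>set as. cmod a < 1" and bs: "\<forall>a\<in>set bs. cmod a < 1" and b: "cmod b = 1"
  shows "spectrum (cmv (as @ bs) b) =
    {\<zeta> \<in> sphere 0 1. fwd_rec \<zeta> as \<zeta> * back_rec \<zeta> bs b = 1}"
proof -
  have "\<zeta> * back_rec \<zeta> (as @ bs) b = 1 \<longleftrightarrow> fwd_rec \<zeta> as \<zeta> * back_rec \<zeta> bs b = 1"
    if "cmod \<zeta> = 1" for \<zeta>
    unfolding back_rec_append
    by (rule back_rec_eq_iff_fwd_rec_eq[OF that as back_rec_unimodular[OF that bs b] that])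
  moreover have "\<forall>a\<in>set (as @ bs). cmod a < 1" using as bs by auto
  ultimately show ?thesis
    unfolding spectrum_cmv[OF \<open>\<forall>a\<in>set (as @ bs). cmod a < 1\<close> b]
    by (intro Collect_cong conj_cong) simp_all
qed

section \<open>The spectra in (i) and (ii) as level sets\<close>

theorem theorem1p1:
  fixes n :: nat and \<alpha> :: "nat \<Rightarrow> complex" and b\<^sub>n :: complex
  assumes "\<forall>j<n. \<alpha> j \<in> ball 0 1" and "b\<^sub>n \<in> sphere 0 1"
  shows
    "(\<forall>\<beta> \<in> sphere 0 1 - {1}. \<forall>m\<le>n.
        strictly_interlace
          (spectrum (cmv (map \<alpha> [0..<n]) b\<^sub>n))
          (spectrum (cmv (map \<alpha> [0..<m] @ map (\<lambda>j. \<beta> * \<alpha> j) [m..<n]) (\<beta> * b\<^sub>n))))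
     \<and>
     (\<forall>m<n. \<forall>b\<^sub>m \<in> sphere 0 1.
        let \<sigma>\<^sub>n = spectrum (cmv (map \<alpha> [0..<n]) b\<^sub>n);
            \<sigma>\<^sub>m = spectrum (cmv (map \<alpha> [0..<m]) b\<^sub>m);
            C = {\<zeta> \<in> sphere 0 1. back_rec \<zeta> (map \<alpha> [m..<n]) b\<^sub>n = b\<^sub>m};
            \<gamma>\<^sub>m = (\<alpha> m - b\<^sub>m) / (cnj (\<alpha> m) * b\<^sub>m - 1);
            D = diag_block_mat [const_mat1 \<gamma>\<^sub>m, 1\<^sub>m (n - m - 1)];
            N = cmv (map \<alpha> [m + 1..<n]) b\<^sub>n * D;
            A = C \<inter> \<sigma>\<^sub>m;
            B = spectrum N - A
        in finite (\<sigma>\<^sub>n \<inter> \<sigma>\<^sub>m) \<and> card (\<sigma>\<^sub>n \<inter> \<sigma>\<^sub>m) \<le> min (m + 1) (n - m) \<and>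
           \<sigma>\<^sub>n \<inter> \<sigma>\<^sub>m = A \<and>
           A = spectrum N \<inter> \<sigma>\<^sub>m \<and>
           strictly_interlace (\<sigma>\<^sub>n - A) (\<sigma>\<^sub>m \<union> B))"
proof (intro conjI ballI allI impI)
  have b\<^sub>n: "cmod b\<^sub>n = 1" using assms(2) by simp
  have disc: "\<forall>a\<in>set (map \<alpha> [i..<j]). cmod a < 1" if "j \<le> n" for i j
    using assms(1) that by auto
  have split: "map \<alpha> [0..<n] = map \<alpha> [0..<m] @ map \<alpha> [m..<n]" if "m \<le> n" for m
    using upt_add_eq_append[of 0 m "n - m"] that by simp
  \<comment> \<open>The degree is m from the entries and 1 from the starting value
    \<open>\<zeta>\<close>.\<close>
  have fwd: "\<exists>\<phi>. circle_lift (m + 1) (\<lambda>\<zeta>. fwd_rec \<zeta> (map \<alpha> [0..<m]) \<zeta>) \<phi>" if "m \<le> n" for m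
    using circle_lift_fwd_rec[OF disc[OF that] circle_lift_ident, of 0] by simp
  have bwd: "\<exists>\<phi>. circle_lift (n - m) (\<lambda>\<zeta>. back_rec \<zeta> (map \<alpha> [m..<n]) b\<^sub>n) \<phi>" for m
    using circle_lift_back_rec[OF disc[of n m] b\<^sub>n] by simp
  {
    fix \<beta> :: complex and m :: nat assume \<beta>: "\<beta> \<in> sphere 0 1 - {1}" and m: "m \<le> n"
    define F where "F \<zeta> = fwd_rec \<zeta> (map \<alpha> [0..<m]) \<zeta> * back_rec \<zeta> (map \<alpha> [m..<n]) b\<^sub>n" for \<zeta>
    obtain \<phi> where F: "circle_lift (m + 1 + (n - m)) F \<phi>"
      using fwd[OF m] bwd[of m] circle_lift_mult unfolding F_def[abs_def] by blast
    have "spectrum (cmv (map \<alpha> [0..<n]) b\<^sub>n) = {\<zeta> \<in> sphere 0 1. F \<zeta> = 1}"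
      unfolding split[OF m] F_def by (rule spectrum_cmv_append[OF disc disc b\<^sub>n]) (use m in simp_all)
    moreover have "spectrum (cmv (map \<alpha> [0..<m] @ map (\<lambda>j. \<beta> * \<alpha> j) [m..<n]) (\<beta> * b\<^sub>n)) =
        {\<zeta> \<in> sphere 0 1. F \<zeta> = cnj \<beta>}"
    proof -
      have \<beta>_norm: "cmod \<beta> = 1" using \<beta> by simp
      have map_eq: "map (\<lambda>j. \<beta> * \<alpha> j) [m..<n] = map ((*) \<beta>) (map \<alpha> [m..<n])" by simp
      have "\<forall>a\<in>set (map ((*) \<beta>) (map \<alpha> [m..<n])). cmod a < 1"
        using disc[of n m] \<beta>_norm by (simp add: norm_mult)
      then have "spectrum (cmv (map \<alpha> [0..<m] @ map (\<lambda>j. \<beta> * \<alpha> j) [m..<n]) (\<beta> * b\<^sub>n)) =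
          {\<zeta> \<in> sphere 0 1. fwd_rec \<zeta> (map \<alpha> [0..<m]) \<zeta> *
             back_rec \<zeta> (map ((*) \<beta>) (map \<alpha> [m..<n])) (\<beta> * b\<^sub>n) = 1}"
        unfolding map_eq using disc[OF m, of 0] \<beta>_norm b\<^sub>n
        by (intro spectrum_cmv_append) (simp_all add: norm_mult)
      also have "\<dots> = {\<zeta> \<in> sphere 0 1. \<beta> * F \<zeta> = 1}"
        unfolding back_rec_rotate[OF \<beta>_norm] F_def by (simp add: ac_simps)
      also have "\<dots> = {\<zeta> \<in> sphere 0 1. F \<zeta> = cnj \<beta>}"
        by (simp only: unimodular_mult_eq_1_iff[OF \<beta>_norm])
      finally show ?thesis .
    qed
    moreover have "1 \<noteq> cnj \<beta>" using \<beta> by (metis DiffE complex_cnj_cnj complex_cnj_one singletonI)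
    ultimately show "strictly_interlace (spectrum (cmv (map \<alpha> [0..<n]) b\<^sub>n))
        (spectrum (cmv (map \<alpha> [0..<m] @ map (\<lambda>j. \<beta> * \<alpha> j) [m..<n]) (\<beta> * b\<^sub>n)))"
      using strictly_interlace_level_sets[OF F, of 1 "cnj \<beta>"] \<beta> by simp
  }
  fix m :: nat and b\<^sub>m :: complex assume m: "m < n" and b\<^sub>m': "b\<^sub>m \<in> sphere 0 1"
  define \<sigma>\<^sub>n where "\<sigma>\<^sub>n = spectrum (cmv (map \<alpha> [0..<n]) b\<^sub>n)"
  define \<sigma>\<^sub>m where "\<sigma>\<^sub>m = spectrum (cmv (map \<alpha> [0..<m]) b\<^sub>m)"
  define C where "C = {\<zeta> \<in> sphere 0 1. back_rec \<zeta> (map \<alpha> [m..<n]) b\<^sub>n = b\<^sub>m}"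
  define \<gamma> where "\<gamma> = (\<alpha> m - b\<^sub>m) / (cnj (\<alpha> m) * b\<^sub>m - 1)"
  define N where "N = cmv (map \<alpha> [m + 1..<n]) b\<^sub>n * diag_block_mat [const_mat1 \<gamma>, 1\<^sub>m (n - m - 1)]"
  \<comment> \<open>The unimodular constants in \<open>F\<close> and \<open>G\<close> cancel in the
    product and normalise both factors to level 1.\<close>
  define F where "F \<zeta> = fwd_rec \<zeta> (map \<alpha> [0..<m]) \<zeta> * b\<^sub>m" for \<zeta>
  define G where "G \<zeta> = cnj b\<^sub>m * back_rec \<zeta> (map \<alpha> [m..<n]) b\<^sub>n" for \<zeta>
  have b\<^sub>m: "cmod b\<^sub>m = 1" using b\<^sub>m' by simp
  obtain s where s: "b\<^sub>m = cis s" using sphere_eq_cis[OF b\<^sub>m'] by blast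
  obtain \<phi> where F: "circle_lift (m + 1) F \<phi>"
    using fwd[of m] m circle_lift_mult[OF _ circle_lift_const[of s]]
    unfolding F_def[abs_def] s by fastforce
  obtain \<psi> where G: "circle_lift (n - m) G \<psi>"
    using bwd[of m] circle_lift_mult[OF circle_lift_const[of "- s"]]
    unfolding G_def[abs_def] s cis_cnj by fastforce
  have \<alpha>\<^sub>m: "cmod (\<alpha> m) < 1" using assms(1) m by simp
  have \<gamma>: "cmod \<gamma> = 1" and \<gamma>_eq: "\<gamma> = (b\<^sub>m - \<alpha> m) / (1 - cnj (\<alpha> m) * b\<^sub>m)"
  proof -
    show *: "\<gamma> = (b\<^sub>m - \<alpha> m) / (1 - cnj (\<alpha> m) * b\<^sub>m)"
      unfolding \<gamma>_def by (metis minus_diff_eq minus_divide_divide)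
    show "cmod \<gamma> = 1"
      using moebius_unimodular[of "- \<alpha> m" b\<^sub>m] \<alpha>\<^sub>m b\<^sub>m by (simp add: *)
  qed
  have \<sigma>\<^sub>m: "\<sigma>\<^sub>m = {\<zeta> \<in> sphere 0 1. F \<zeta> = 1}"
    \<comment> \<open>With an empty tail the second factor is the constant
      \<open>b\<^sub>m\<close>.\<close>
    using spectrum_cmv_append[OF disc[of m 0], of "[]" b\<^sub>m] m b\<^sub>m by (simp add: \<sigma>\<^sub>m_def F_def)
  have "F \<zeta> * G \<zeta> = cnj b\<^sub>m * b\<^sub>m * (fwd_rec \<zeta> (map \<alpha> [0..<m]) \<zeta> * back_rec \<zeta> (map \<alpha> [m..<n]) b\<^sub>n)" for \<zeta>
    by (simp add: F_def G_def ac_simps)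
  then have FG: "F \<zeta> * G \<zeta> = fwd_rec \<zeta> (map \<alpha> [0..<m]) \<zeta> * back_rec \<zeta> (map \<alpha> [m..<n]) b\<^sub>n" for \<zeta>
    using cnj_unimodular[OF b\<^sub>m] by simp
  have \<sigma>\<^sub>n: "\<sigma>\<^sub>n = {\<zeta> \<in> sphere 0 1. F \<zeta> * G \<zeta> = 1}"
    unfolding FG \<sigma>\<^sub>n_def split[OF less_imp_le[OF m]]
    by (rule spectrum_cmv_append[OF disc disc b\<^sub>n]) (use m in simp_all)
  have C: "C = {\<zeta> \<in> sphere 0 1. G \<zeta> = 1}"
    using b\<^sub>m by (simp add: C_def G_def unimodular_mult_eq_1_iff)
  have N: "spectrum N = C"
  proof -
    have map_eq: "map \<alpha> [m..<n] = \<alpha> m # map \<alpha> [m + 1..<n]" using m by (simp add: upt_conv_Cons)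
    \<comment> \<open>\<open>\<gamma>\<close> is the preimage of \<open>b\<^sub>m\<close> under the
      Moebius map with parameter \<open>\<alpha> m\<close>, which is the last step of the backward
      recursion.\<close>
    have "\<zeta> * back_rec \<zeta> (map \<alpha> [m + 1..<n]) b\<^sub>n = \<gamma> \<longleftrightarrow> back_rec \<zeta> (map \<alpha> [m..<n]) b\<^sub>n = b\<^sub>m"
      if "cmod \<zeta> = 1" for \<zeta>
    proof -
      define w where "w = \<zeta> * back_rec \<zeta> (map \<alpha> [m + 1..<n]) b\<^sub>n"
      have "cmod w = 1"
        using back_rec_unimodular[OF that disc[of n "m + 1"] b\<^sub>n] that by (simp add: w_def norm_mult)
      then have "1 + cnj (\<alpha> m) * w \<noteq> 0" "1 - cnj (\<alpha> m) * b\<^sub>m \<noteq> 0"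
        using moebius_denominator_nonzero[OF \<alpha>\<^sub>m] b\<^sub>m by blast+
      then have "w = \<gamma> \<longleftrightarrow> (w + \<alpha> m) / (1 + cnj (\<alpha> m) * w) = b\<^sub>m"
        by (auto simp: \<gamma>_eq divide_eq_eq eq_divide_eq algebra_simps)
      then show ?thesis unfolding map_eq back_rec_Cons[OF that] w_def .
    qed
    then have "{\<zeta> \<in> sphere 0 1. \<zeta> * back_rec \<zeta> (map \<alpha> [m + 1..<n]) b\<^sub>n = \<gamma>} = C"
      by (auto simp: C_def)
    then show ?thesis
      unfolding N_def using spectrum_cmv_mult_diag[OF disc[of n "m + 1"] b\<^sub>n \<gamma>] by simp
  qed
  have inter: "\<sigma>\<^sub>n \<inter> \<sigma>\<^sub>m = C \<inter> \<sigma>\<^sub>m" unfolding \<sigma>\<^sub>n \<sigma>\<^sub>m C by auto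
  \<comment> \<open>The spectrum of \<open>N\<close> is \<open>C\<close>, so the set B of the
    statement is \<open>C - C \<inter> \<sigma>\<^sub>m\<close>.\<close>
  have union: "\<sigma>\<^sub>m \<union> (C - C \<inter> \<sigma>\<^sub>m) = \<sigma>\<^sub>m \<union> C" by blast
  have "strictly_interlace (\<sigma>\<^sub>n - C \<inter> \<sigma>\<^sub>m) (\<sigma>\<^sub>m \<union> C)"
    "finite (C \<inter> \<sigma>\<^sub>m)" "card (C \<inter> \<sigma>\<^sub>m) \<le> min (m + 1) (n - m)"
    using strictly_interlace_product[OF F _ G] m
    unfolding \<sigma>\<^sub>n[symmetric] \<sigma>\<^sub>m[symmetric] C[symmetric] Int_commute[of \<sigma>\<^sub>m] by simp_all
  then show "let \<sigma>\<^sub>n = spectrum (cmv (map \<alpha> [0..<n]) b\<^sub>n);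
            \<sigma>\<^sub>m = spectrum (cmv (map \<alpha> [0..<m]) b\<^sub>m);
            C = {\<zeta> \<in> sphere 0 1. back_rec \<zeta> (map \<alpha> [m..<n]) b\<^sub>n = b\<^sub>m};
            \<gamma>\<^sub>m = (\<alpha> m - b\<^sub>m) / (cnj (\<alpha> m) * b\<^sub>m - 1);
            D = diag_block_mat [const_mat1 \<gamma>\<^sub>m, 1\<^sub>m (n - m - 1)];
            N = cmv (map \<alpha> [m + 1..<n]) b\<^sub>n * D;
            A = C \<inter> \<sigma>\<^sub>m;
            B = spectrum N - A
        in finite (\<sigma>\<^sub>n \<inter> \<sigma>\<^sub>m) \<and> card (\<sigma>\<^sub>n \<inter> \<sigma>\<^sub>m) \<le> min (m + 1) (n - m) \<and>
           \<sigma>\<^sub>n \<inter> \<sigma>\<^sub>m = A \<and>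
           A = spectrum N \<inter> \<sigma>\<^sub>m \<and>
           strictly_interlace (\<sigma>\<^sub>n - A) (\<sigma>\<^sub>m \<union> B)"
    unfolding Let_def \<sigma>\<^sub>n_def[symmetric] \<sigma>\<^sub>m_def[symmetric] C_def[symmetric] \<gamma>_def[symmetric]
      N_def[symmetric] N inter union by simp
qed

end
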